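(* Let $d$ be a positive integer and let $A\subseteq\mathbb{R}^d$ be a bounded set such that its topological boundary $\partial A$ is strip-null. Then $A$ is both distance Kolmogorov and measure Kolmogorov.
   Context: $\lambda$ denotes Lebesgue measure on $\mathbb{R}^d$, $|\cdot|$ the Euclidean norm. A set $P\subseteq\mathbb{R}^d$ is called a polyhedron if its topological boundary $\partial P$ can be covered by finitely many (affine) hyperplanes. A bounded measurable set $A\subseteq\mathbb{R}^d$ is measure Kolmogorov if for every $\varepsilon>0$ there is a 1-Lipschitz map $f:A\to\mathbb{R}^d$ such that $f(A)$ is a polyhedron and $\lambda(f(A))>\lambda(A)-\varepsilon$. A bounded set $A\subseteq\mathbb{R}^d$ is distance Kolmogorov if for every $\varepsilon>0$ there is a 1-Lipschitz map $f:A\to\mathbb{R}^d$ such that $f(A)$ is a polyhedron and $|f(x)-x|\le\varepsilon$ for every $x\in A$. A strip of width $w>0$ in $\mathbb{R}^d$ is the closed region between two parallel hyperplanes at distance $w$. A set in $\mathbb{R}^d$ is strip-null if for every $\varepsilon>0$ it can be covered by countably many strips of total width at most $\varepsilon$. *)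

theory Defs
  imports "HOL-Analysis.Analysis"
begin

definition affine_hyperplane :: "'a::euclidean_space set \<Rightarrow> bool" where
  "affine_hyperplane H \<longleftrightarrow> (\<exists>a b. a \<noteq> 0 \<and> H = {x. a \<bullet> x = b})"

(* Not the library's "polyhedron" (a finite intersection of half-spaces):
   no convexity, closedness or boundedness is required here. *)
definition general_polyhedron :: "'a::euclidean_space set \<Rightarrow> bool" where
  "general_polyhedron P \<longleftrightarrow>
     (\<exists>\<H>. finite \<H> \<and> (\<forall>H\<in>\<H>. affine_hyperplane H) \<and> frontier P \<subseteq> \<Union>\<H>)"

(* The image of A is bounded, and its frontier is a null set, so it is
   Lebesgue measurable of finite measure and the real-valued measure is
   meaningful. *)
definition measure_kolmogorov :: "'a::euclidean_space set \<Rightarrow> bool" where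
  "measure_kolmogorov A \<longleftrightarrow> bounded A \<and> A \<in> sets lebesgue \<and>
     (\<forall>\<epsilon>>0. \<exists>f :: 'a \<Rightarrow> 'a. 1-lipschitz_on A f \<and> general_polyhedron (f ` A) \<and>
        measure lebesgue (f ` A) > measure lebesgue A - \<epsilon>)"

definition distance_kolmogorov :: "'a::euclidean_space set \<Rightarrow> bool" where
  "distance_kolmogorov A \<longleftrightarrow> bounded A \<and>
     (\<forall>\<epsilon>>0. \<exists>f :: 'a \<Rightarrow> 'a. 1-lipschitz_on A f \<and> general_polyhedron (f ` A) \<and>
        (\<forall>x\<in>A. norm (f x - x) \<le> \<epsilon>))"

(* As the normal a is a unit vector, w is the distance between the two
   bounding hyperplanes. *)
definition strip :: "real \<Rightarrow> 'a::euclidean_space set \<Rightarrow> bool" where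
  "strip w S \<longleftrightarrow> w > 0 \<and> (\<exists>a b. norm a = 1 \<and> S = {x. b \<le> a \<bullet> x \<and> a \<bullet> x \<le> b + w})"

(* The index set I may be finite or infinite.  Summability is stated
   separately because infsum is 0 on non-summable families. *)
definition strip_null :: "'a::euclidean_space set \<Rightarrow> bool" where
  "strip_null E \<longleftrightarrow>
     (\<forall>\<epsilon>>0. \<exists>(I :: nat set) (S :: nat \<Rightarrow> 'a set) (w :: nat \<Rightarrow> real).
        (\<forall>i\<in>I. strip (w i) (S i)) \<and> E \<subseteq> (\<Union>i\<in>I. S i) \<and>
        w summable_on I \<and> infsum w I \<le> \<epsilon>)"

end

theory Submission
  imports Defs
begin

text \<open>By compactness finitely many open strips \<open>\<bar>a\<^sub>i \<bullet> x - b\<^sub>i\<bar> < c\<^sub>i\<close> of small total width cover the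
  frontier of \<open>A\<close>. Let \<open>h\<close> be the convex envelope of
  \<open>x \<mapsto> norm x\<^sup>2 / 2 - (\<Sum>i. c\<^sub>i * \<bar>a\<^sub>i \<bullet> x - b\<^sub>i\<bar>)\<close>. Its gradient \<open>f\<close> is 1-Lipschitz, surjective and
  moves no point by more than \<open>\<Sum>i. c\<^sub>i\<close>. Because of the concave kinks, \<open>h\<close> is strictly smaller
  than the function itself on each strip, and there \<open>f\<close> takes values in finitely many hyperplanes.
  Off these hyperplanes \<open>f\<close> is locally invertible by translations, so they contain the frontier
  of \<open>f ` A\<close>. Points of \<open>A - f ` A\<close> are close to the null set \<open>frontier A\<close>, so little measure is lost.
  Concretely, the conjugate of \<open>h\<close> is \<open>norm y\<^sup>2 / 2 + g y\<close> with \<open>g\<close> a maximum of finitely many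
  affine functions, and \<open>f\<close> is the resolvent of the subdifferential of \<open>g\<close>.\<close>

section \<open>Maxima of finitely many affine functions and their subgradients\<close>

text \<open>A pair in \<open>P\<close> consists of a slope and a constant term. On the empty set
  \<open>Max\<close> is unspecified, hence the recurring hypothesis
  \<open>P \<noteq> {}\<close>.\<close>

definition max_affine :: "('a::real_inner \<times> real) set \<Rightarrow> 'a \<Rightarrow> real" where
  "max_affine P y = (MAX (p, k) \<in> P. p \<bullet> y + k)"

lemma max_affine_ge:
  assumes "finite P" "(p, k) \<in> P"
  shows "p \<bullet> y + k \<le> max_affine P y"
proof -
  have "(\<lambda>(p, k). p \<bullet> y + k) (p, k) \<le> max_affine P y"
    unfolding max_affine_def using assms by (intro Max_ge) (auto simp del: split_conv)
  then show ?thesis by simp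
qed

lemma max_affine_attained:
  assumes "finite P" "P \<noteq> {}"
  obtains p k where "(p, k) \<in> P" "max_affine P y = p \<bullet> y + k"
proof -
  have "max_affine P y \<in> (\<lambda>(p, k). p \<bullet> y + k) ` P"
    unfolding max_affine_def using assms by (intro Max_in) auto
  then show ?thesis using that by auto
qed

definition subgradient :: "('a::real_inner \<Rightarrow> real) \<Rightarrow> 'a \<Rightarrow> 'a \<Rightarrow> bool" where
  "subgradient g y \<xi> \<longleftrightarrow> (\<forall>z. g y + \<xi> \<bullet> (z - y) \<le> g z)"

lemma subgradient_max_affine:
  assumes "finite P" "(p, k) \<in> P" "max_affine P y = p \<bullet> y + k"
  shows "subgradient (max_affine P) y p"
  unfolding subgradient_def
  using max_affine_ge[OF assms(1,2)] assms(3) by (simp add: inner_diff_right add.commute)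

lemma convex_max_affine:
  assumes "finite P" "P \<noteq> {}"
  shows "convex_on UNIV (max_affine P)"
proof (intro convex_onI)
  fix t :: real and x y :: 'a
  assume t: "0 < t" "t < 1"
  obtain p k where pk: "(p, k) \<in> P"
    "max_affine P ((1 - t) *\<^sub>R x + t *\<^sub>R y) = p \<bullet> ((1 - t) *\<^sub>R x + t *\<^sub>R y) + k"
    using max_affine_attained[OF assms] .
  have "p \<bullet> ((1 - t) *\<^sub>R x + t *\<^sub>R y) + k = (1 - t) * (p \<bullet> x + k) + t * (p \<bullet> y + k)"
    by (simp add: algebra_simps)
  also have "\<dots> \<le> (1 - t) * max_affine P x + t * max_affine P y"
    using t max_affine_ge[OF assms(1) pk(1)] by (intro add_mono mult_left_mono) auto
  finally show "max_affine P ((1 - t) *\<^sub>R x + t *\<^sub>R y)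
      \<le> (1 - t) * max_affine P x + t * max_affine P y"
    using pk(2) by simp
qed auto

text \<open>A slope active at \<open>z\<close> bounds the increase from \<open>y\<close> to
  \<open>z\<close>. Exchanging \<open>y\<close> and \<open>z\<close> turns this into a Lipschitz
  bound.\<close>

lemma max_affine_diff_le:
  assumes "finite P" "P \<noteq> {}" "\<And>p k. (p, k) \<in> P \<Longrightarrow> norm p \<le> C"
  shows "max_affine P z - max_affine P y \<le> C * norm (z - y)"
proof -
  obtain p k where pk: "(p, k) \<in> P" "max_affine P z = p \<bullet> z + k"
    using max_affine_attained[OF assms(1,2)] .
  have "max_affine P z - max_affine P y \<le> p \<bullet> (z - y)"
    using pk max_affine_ge[OF assms(1) pk(1), of y] by (simp add: inner_diff_right)
  also have "\<dots> \<le> norm p * norm (z - y)" by (rule norm_cauchy_schwarz)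
  also have "\<dots> \<le> C * norm (z - y)" using assms(3) pk(1) by (intro mult_right_mono) auto
  finally show ?thesis .
qed

text \<open>Testing the subgradient inequality at \<open>y + \<xi>\<close> bounds the square of
  \<open>norm \<xi>\<close> by \<open>C * norm \<xi>\<close>.\<close>

lemma subgradient_norm_le:
  assumes "finite P" "P \<noteq> {}" "\<And>p k. (p, k) \<in> P \<Longrightarrow> norm p \<le> C"
    and "subgradient (max_affine P) y \<xi>"
  shows "norm \<xi> \<le> C"
proof (cases "\<xi> = 0")
  case True
  obtain q where "q \<in> P" using assms(2) by auto
  then have "norm (fst q) \<le> C" using assms(3)[of "fst q" "snd q"] by simp
  then show ?thesis using True norm_ge_zero[of "fst q"] by (simp del: norm_ge_zero)
next
  case False
  have "norm \<xi> * norm \<xi> \<le> max_affine P (y + \<xi>) - max_affine P y"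
    using assms(4)[unfolded subgradient_def, rule_format, of "y + \<xi>"]
    by (simp add: dot_square_norm power2_eq_square)
  also have "\<dots> \<le> C * norm \<xi>"
    using max_affine_diff_le[OF assms(1-3), where z = "y + \<xi>" and y = y] by simp
  finally show ?thesis using False by (simp add: mult_le_cancel_right)
qed

section \<open>The resolvent of the subdifferential\<close>

text \<open>The point \<open>y\<close> is the proximal point of \<open>x\<close>: it minimizes half
  the squared distance to \<open>x\<close> plus \<open>max_affine P\<close>, and the claim is the
  first-order optimality condition.\<close>

lemma resolvent_exists:
  fixes x :: "'a::euclidean_space"
  assumes "finite P" "P \<noteq> {}"
  shows "\<exists>y. subgradient (max_affine P) y (x - y)"
proof -
  let ?g = "max_affine P"
  define F where "F = (\<lambda>y. (norm (y - x))\<^sup>2 / 2 + ?g y)"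
  define C where "C = (\<Sum>q\<in>P. norm (fst q))"
  have C: "norm p \<le> C" if "(p, k) \<in> P" for p k
    unfolding C_def using member_le_sum[OF that, of "\<lambda>q. norm (fst q)"] assms(1) by simp
  have C0: "0 \<le> C" unfolding C_def by (intro sum_nonneg) auto
  have lip: "C-lipschitz_on UNIV ?g"
  proof (rule lipschitz_onI)
    fix z y :: 'a
    show "dist (?g z) (?g y) \<le> C * dist z y"
      using max_affine_diff_le[OF assms C, where z = z and y = y] max_affine_diff_le[OF assms C, where z = y and y = z]
      by (auto simp: dist_norm norm_minus_commute abs_le_iff)
  qed (fact C0)
  \<comment> \<open>Moving away from \<open>x\<close> lowers \<open>?g\<close> by at most
    \<open>C\<close> per unit of distance. Beyond radius \<open>2 * C\<close> the quadratic term
    outweighs this gain, so a minimum over this ball is global.\<close>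
  have cont: "continuous_on (cball x (2 * C)) F"
    unfolding F_def
    by (intro continuous_intros continuous_on_subset[OF lipschitz_on_continuous_on[OF lip]]) auto
  obtain y where y: "y \<in> cball x (2 * C)" "\<And>z. z \<in> cball x (2 * C) \<Longrightarrow> F y \<le> F z"
    using continuous_attains_inf[OF compact_cball _ cont] C0 by auto
  have ymin: "F y \<le> F z" for z
  proof (cases "z \<in> cball x (2 * C)")
    case False
    then have "2 * C < norm (z - x)" by (simp add: dist_norm norm_minus_commute)
    then have "2 * C * norm (z - x) \<le> norm (z - x) * norm (z - x)"
      by (intro mult_right_mono) auto
    moreover have "?g x - ?g z \<le> C * norm (z - x)"
      using max_affine_diff_le[OF assms C, where z = x and y = z] by (simp add: norm_minus_commute)
    moreover have "F y \<le> F x" using y(2) C0 by auto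
    ultimately show ?thesis unfolding F_def by (simp add: power2_eq_square)
  qed (use y in auto)
  have "?g y + (x - y) \<bullet> (z - y) \<le> ?g z" for z
  proof -
    \<comment> \<open>Minimality of \<open>y\<close> is tested against a point of the segment from
      \<open>y\<close> to \<open>z\<close>. After division by \<open>t\<close>, only the quadratic
      error still depends on \<open>t\<close>, and it vanishes as \<open>t\<close> tends to 0 from
      the right.\<close>
    have step: "(x - y) \<bullet> (z - y) + ?g y - ?g z \<le> t * ((norm (z - y))\<^sup>2 / 2)"
      if t: "0 < t" "t < 1" for t
    proof -
      have "?g ((1 - t) *\<^sub>R y + t *\<^sub>R z) \<le> (1 - t) * ?g y + t * ?g z"
        using convex_onD[OF convex_max_affine[OF assms], of t y z] t by simp
      moreover have "(norm ((1 - t) *\<^sub>R y + t *\<^sub>R z - x))\<^sup>2 =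
          (norm (y - x))\<^sup>2 - 2 * t * ((x - y) \<bullet> (z - y)) + t * t * (norm (z - y))\<^sup>2"
        unfolding power2_norm_eq_inner
        by (simp add: algebra_simps inner_commute)
      ultimately have "t * ((x - y) \<bullet> (z - y) + ?g y - ?g z) \<le> t * (t * ((norm (z - y))\<^sup>2 / 2))"
        using ymin[of "(1 - t) *\<^sub>R y + t *\<^sub>R z"] unfolding F_def by (simp add: algebra_simps)
      then show ?thesis using t by (simp only: mult_le_cancel_left_pos)
    qed
    have lim: "((\<lambda>t. t * ((norm (z - y))\<^sup>2 / 2)) \<longlongrightarrow> 0 * ((norm (z - y))\<^sup>2 / 2)) (at_right (0::real))"
      by (intro tendsto_intros)
    have "\<forall>\<^sub>F t in at_right (0::real). (x - y) \<bullet> (z - y) + ?g y - ?g z \<le> t * ((norm (z - y))\<^sup>2 / 2)"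
      using step by (auto simp: eventually_at_right_field intro!: exI[of _ 1])
    from tendsto_lowerbound[OF lim this] show ?thesis by simp
  qed
  then show ?thesis unfolding subgradient_def by blast
qed

text \<open>Adding the two subgradient inequalities gives monotonicity of the subdifferential;
  Cauchy-Schwarz then finishes.\<close>

lemma resolvent_nonexpansive:
  assumes "subgradient g y (x - y)" "subgradient g y' (x' - y')"
  shows "dist y y' \<le> dist x x'"
proof (cases "y = y'")
  case False
  have "g y + (x - y) \<bullet> (y' - y) \<le> g y'" "g y' + (x' - y') \<bullet> (y - y') \<le> g y"
    using assms unfolding subgradient_def by blast+
  then have "(x - y) \<bullet> (y' - y) + (x' - y') \<bullet> (y - y') \<le> 0" by linarith
  then have "(y - y') \<bullet> (y - y') \<le> (x - x') \<bullet> (y - y')"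
    by (simp add: algebra_simps inner_commute)
  also have "\<dots> \<le> norm (x - x') * norm (y - y')" by (rule norm_cauchy_schwarz)
  finally show ?thesis
    using False by (simp add: dot_square_norm power2_eq_square dist_norm mult_le_cancel_right)
qed simp

text \<open>Nonexpansiveness at equal arguments makes the resolvent single-valued, so the
  subgradient condition characterizes \<open>f x\<close>. The displacement \<open>x - f x\<close> is
  itself a subgradient and inherits the bound on the slopes.\<close>

lemma resolvent_map:
  assumes "finite P" "P \<noteq> {}" "\<And>p k. (p, k) \<in> P \<Longrightarrow> norm p \<le> C"
  obtains f :: "'a::euclidean_space \<Rightarrow> 'a" where
    "1-lipschitz_on UNIV f" "\<forall>x. norm (f x - x) \<le> C"
    "\<forall>x y. f x = y \<longleftrightarrow> subgradient (max_affine P) y (x - y)"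
proof -
  obtain f where f: "\<And>x. subgradient (max_affine P) (f x) (x - f x)"
    using resolvent_exists[OF assms(1,2)] by metis
  have iff: "f x = y \<longleftrightarrow> subgradient (max_affine P) y (x - y)" for x y
    using f resolvent_nonexpansive[OF f, of y x x] by auto
  have "1-lipschitz_on UNIV f"
    by (intro lipschitz_onI) (use resolvent_nonexpansive[OF f f] in auto)
  moreover have "norm (f x - x) \<le> C" for x
    using subgradient_norm_le[OF assms f] by (simp add: norm_minus_commute)
  ultimately show ?thesis using that iff by blast
qed

section \<open>Creases, local affinity and the affine pieces attached to strips\<close>

text \<open>Each member is the locus where two of the affine functions agree. Pairs with equal
  slopes are left out because they would not give hyperplanes.\<close>

definition creases :: "('a::euclidean_space \<times> real) set \<Rightarrow> 'a set set" where
  "creases P = (\<lambda>((p, k), (q, l)). {y. (p - q) \<bullet> y = l - k}) ` {(u, v) \<in> P \<times> P. fst u \<noteq> fst v}"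

lemma finite_creases: "finite P \<Longrightarrow> finite (creases P)"
  unfolding creases_def
  by (rule finite_imageI, rule finite_subset[of _ "P \<times> P"]) auto

lemma affine_hyperplane_creases:
  assumes "H \<in> creases P"
  shows "affine_hyperplane H"
proof -
  obtain p k q l where "p \<noteq> q" and H: "H = {y. (p - q) \<bullet> y = l - k}"
    using assms unfolding creases_def by auto
  then have "p - q \<noteq> 0" by simp
  then show ?thesis using H unfolding affine_hyperplane_def by blast
qed

lemma not_in_creases:
  assumes "y \<notin> \<Union>(creases P)" "(p, k) \<in> P" "(q, l) \<in> P" "p \<noteq> q"
  shows "p \<bullet> y + k \<noteq> q \<bullet> y + l"
proof
  assume eq: "p \<bullet> y + k = q \<bullet> y + l"
  have "{y. (p - q) \<bullet> y = l - k} \<in> creases P"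
    unfolding creases_def using assms by (intro image_eqI[of _ _ "((p, k), (q, l))"]) auto
  moreover have "(p - q) \<bullet> y = l - k" using eq by (simp add: inner_diff_left)
  ultimately show False using assms(1) by blast
qed

text \<open>Off the creases, every piece whose slope differs from the active one is strictly smaller
  at \<open>y\<close>, and remains below it nearby by continuity. A piece with the same slope
  differs only by a constant and can never overtake.\<close>

lemma max_affine_locally_affine:
  assumes "finite P" "P \<noteq> {}" "y \<notin> \<Union>(creases P)"
  obtains p k \<delta> where "(p, k) \<in> P" "\<delta> > 0"
    "\<And>z. z \<in> ball y \<delta> \<Longrightarrow> max_affine P z = p \<bullet> z + k"
proof -
  obtain p k where pk: "(p, k) \<in> P" "max_affine P y = p \<bullet> y + k"
    using max_affine_attained[OF assms(1,2)] .
  have "\<forall>\<^sub>F z in nhds y. q \<bullet> z + l \<le> p \<bullet> z + k" if ql: "(q, l) \<in> P" for q l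
  proof (cases "p = q")
    case True
    then show ?thesis using max_affine_ge[OF assms(1) ql, of y] pk(2) by (auto intro: always_eventually)
  next
    case False
    then have "q \<bullet> y + l < p \<bullet> y + k"
      using not_in_creases[OF assms(3) pk(1) ql] max_affine_ge[OF assms(1) ql, of y] pk(2) by auto
    then have "\<forall>\<^sub>F z in nhds y. 0 < (p \<bullet> z + k) - (q \<bullet> z + l)"
      by (intro order_tendstoD(1)[where y = "(p \<bullet> y + k) - (q \<bullet> y + l)"])
        (auto intro!: tendsto_intros filterlim_ident)
    then show ?thesis by eventually_elim simp
  qed
  then have "\<forall>\<^sub>F z in nhds y. \<forall>v\<in>P. fst v \<bullet> z + snd v \<le> p \<bullet> z + k"
    using assms(1) by (intro eventually_ball_finite) auto
  then obtain \<delta> where \<delta>: "\<delta> > 0"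
    "\<And>z. dist z y < \<delta> \<Longrightarrow> \<forall>v\<in>P. fst v \<bullet> z + snd v \<le> p \<bullet> z + k"
    unfolding eventually_nhds_metric by blast
  have "max_affine P z = p \<bullet> z + k" if "z \<in> ball y \<delta>" for z
  proof -
    obtain q l where ql: "(q, l) \<in> P" "max_affine P z = q \<bullet> z + l"
      using max_affine_attained[OF assms(1,2)] .
    then show ?thesis
      using \<delta>(2)[of z] that max_affine_ge[OF assms(1) pk(1), of z] by (force simp: dist_commute)
  qed
  then show ?thesis using that pk(1) \<delta>(1) by blast
qed

lemma subgradient_locally_affine:
  assumes "\<delta> > 0" "\<And>z. z \<in> ball y \<delta> \<Longrightarrow> g z = p \<bullet> z + k" "subgradient g y \<xi>"
  shows "\<xi> = p"
proof (rule ccontr)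
  assume "\<xi> \<noteq> p"
  \<comment> \<open>The step from \<open>y\<close> in direction \<open>\<xi> - p\<close> then has
    length \<open>\<delta> / 2\<close> and stays in the ball.\<close>
  define t where "t = \<delta> / (2 * norm (\<xi> - p))"
  have t: "t > 0" "t * norm (\<xi> - p) < \<delta>" using \<open>\<xi> \<noteq> p\<close> assms(1) unfolding t_def by auto
  have "y + t *\<^sub>R (\<xi> - p) \<in> ball y \<delta>" using t by (simp add: dist_norm)
  then have "t * ((\<xi> - p) \<bullet> (\<xi> - p)) \<le> 0"
    using assms(3)[unfolded subgradient_def, rule_format, of "y + t *\<^sub>R (\<xi> - p)"]
      assms(2)[of y] assms(2)[of "y + t *\<^sub>R (\<xi> - p)"] assms(1)
    by (simp add: algebra_simps)
  then show False using t \<open>\<xi> \<noteq> p\<close> by (metis inner_gt_zero_iff mult_pos_pos not_le right_minus_eq)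
qed

text \<open>For each choice of signs \<open>s\<^sub>i = c\<^sub>i\<close> or \<open>s\<^sub>i = - c\<^sub>i\<close>, take the slope \<open>p = (\<Sum>i. s\<^sub>i *\<^sub>R a\<^sub>i)\<close> and
  choose the constant \<open>k\<close> so that \<open>p \<bullet> y + k = (norm (y + p)\<^sup>2 - norm y\<^sup>2) / 2 - (\<Sum>i. s\<^sub>i * b\<^sub>i)\<close>. Where
  the slope is \<open>p\<close> the preimage of \<open>y\<close> is \<open>x = y + p\<close>, and optimality of \<open>p\<close> compared with the
  vector obtained by flipping the \<open>i\<close>-th sign forces \<open>x\<close> to lie outside the \<open>i\<close>-th strip.\<close>

lemma max_affine_of_strips:
  fixes a :: "'i \<Rightarrow> 'a::euclidean_space" and b c :: "'i \<Rightarrow> real"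
  assumes "finite J" "\<And>i. i \<in> J \<Longrightarrow> norm (a i) = 1" "\<And>i. i \<in> J \<Longrightarrow> c i > 0"
  obtains P where "finite P" "P \<noteq> {}" "\<forall>p k. (p, k) \<in> P \<longrightarrow> norm p \<le> sum c J"
    "\<forall>x y. y \<notin> \<Union>(creases P) \<longrightarrow> subgradient (max_affine P) y (x - y) \<longrightarrow>
       (\<forall>i\<in>J. c i \<le> \<bar>a i \<bullet> x - b i\<bar>)"
proof -
  define s where "s = (\<lambda>T i. if i \<in> T then c i else - c i)"
  define p where "p = (\<lambda>T. \<Sum>i\<in>J. s T i *\<^sub>R a i)"
  define \<sigma> where "\<sigma> = (\<lambda>T. \<Sum>i\<in>J. s T i * b i)"
  define P where "P = (\<lambda>T. (p T, p T \<bullet> p T / 2 - \<sigma> T)) ` Pow J"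
  have fin: "finite P" "P \<noteq> {}" unfolding P_def using assms(1) by auto
  have "norm (p T) \<le> sum c J" for T
    unfolding p_def using assms(2,3) by (intro sum_norm_le) (auto simp: s_def less_imp_le)
  then have bound: "norm q \<le> sum c J" if "(q, k) \<in> P" for q k
    using that unfolding P_def by auto
  have out: "c i \<le> \<bar>a i \<bullet> x - b i\<bar>"
    if y: "y \<notin> \<Union>(creases P)" and sub: "subgradient (max_affine P) y (x - y)" and i: "i \<in> J"
    for x y i
  proof -
    obtain q k \<delta> where q: "(q, k) \<in> P" "\<delta> > 0"
      "\<And>z. z \<in> ball y \<delta> \<Longrightarrow> max_affine P z = q \<bullet> z + k"
      using max_affine_locally_affine[OF fin y] by blast
    have x: "x = y + q" using subgradient_locally_affine[OF q(2,3) sub] by (simp add: algebra_simps)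
    obtain T where T: "T \<subseteq> J" "q = p T" "k = p T \<bullet> p T / 2 - \<sigma> T"
      using q(1) unfolding P_def by auto
    define T' where "T' = (if i \<in> T then T - {i} else insert i T)"
    \<comment> \<open>Flipping the sign replaces \<open>s T i\<close> by \<open>- s T i\<close>, a
      decrease by \<open>e\<close>.\<close>
    define e where "e = 2 * s T i"
    have s': "s T' j = s T j - (if j = i then e else 0)" for j
      unfolding s_def T'_def e_def by auto
    have p': "p T' = p T - e *\<^sub>R a i"
    proof -
      have "p T' = (\<Sum>j\<in>J. s T j *\<^sub>R a j - (if j = i then e *\<^sub>R a i else 0))"
        unfolding p_def s' by (intro sum.cong) (auto simp: scaleR_diff_left)
      then show ?thesis using assms(1) i by (simp add: sum_subtractf p_def)
    qed
    have \<sigma>': "\<sigma> T' = \<sigma> T - e * b i"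
    proof -
      have "\<sigma> T' = (\<Sum>j\<in>J. s T j * b j - (if j = i then e * b i else 0))"
        unfolding \<sigma>_def s' by (intro sum.cong) (auto simp: left_diff_distrib)
      then show ?thesis using assms(1) i by (simp add: sum_subtractf \<sigma>_def)
    qed
    have "T' \<subseteq> J" unfolding T'_def using T(1) i by auto
    then have P': "(p T', p T' \<bullet> p T' / 2 - \<sigma> T') \<in> P" unfolding P_def by blast
    have "p T' \<bullet> y + (p T' \<bullet> p T' / 2 - \<sigma> T') \<le> q \<bullet> y + k"
      using max_affine_ge[OF fin(1) P', of y] q(3)[of y] q(2) by simp
    moreover have "a i \<bullet> a i = 1" using assms(2)[OF i] by (simp add: dot_square_norm)
    \<comment> \<open>As \<open>x = y + q\<close>, the linear terms in \<open>y\<close> and in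
      \<open>p T\<close> merge into \<open>e * (a i \<bullet> x)\<close>. The square
      \<open>e * e / 2\<close> is left over from half the squared norm of
      \<open>p T'\<close>.\<close>
    ultimately have "e * e / 2 \<le> e * (a i \<bullet> x - b i)"
      unfolding p' \<sigma>' T(2,3) x
      by (simp add: algebra_simps inner_commute add_divide_distrib diff_divide_distrib)
    moreover have "e * (a i \<bullet> x - b i) \<le> \<bar>e\<bar> * \<bar>a i \<bullet> x - b i\<bar>"
      by (metis abs_ge_self abs_mult)
    moreover have e: "\<bar>e\<bar> = 2 * c i" "e * e = \<bar>e\<bar> * \<bar>e\<bar>"
      using assms(3)[OF i] unfolding e_def s_def by auto
    ultimately have "\<bar>e\<bar> * c i \<le> \<bar>e\<bar> * \<bar>a i \<bullet> x - b i\<bar>" by simp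
    then show ?thesis using e assms(3)[OF i] by (simp add: mult_le_cancel_left_pos)
  qed
  show ?thesis by (rule that[OF fin]) (use bound out in blast)+
qed

section \<open>Strip-null compact sets: finite covers and measure zero\<close>

lemma strip_null_finite_cover:
  fixes E :: "'a::euclidean_space set"
  assumes "compact E" "strip_null E" "\<epsilon> > 0"
  obtains J :: "nat set" and a :: "nat \<Rightarrow> 'a" and c b where
    "finite J" "\<And>i. i \<in> J \<Longrightarrow> norm (a i) = 1" "\<And>i. i \<in> J \<Longrightarrow> c i > 0" "sum c J \<le> \<epsilon>"
    "E \<subseteq> (\<Union>i\<in>J. {x. \<bar>a i \<bullet> x - b i\<bar> < c i})"
proof -
  obtain I S and w :: "nat \<Rightarrow> real" where S: "\<And>i. i \<in> I \<Longrightarrow> strip (w i) (S i)" "E \<subseteq> (\<Union>i\<in>I. S i)"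
    "w summable_on I" "infsum w I \<le> \<epsilon>"
    using assms(2,3) unfolding strip_null_def by metis
  have "\<exists>a b. norm a = 1 \<and> S i = {x. b \<le> a \<bullet> x \<and> a \<bullet> x \<le> b + w i}" if "i \<in> I" for i
    using S(1)[OF that] unfolding strip_def by blast
  then obtain a b where ab: "\<And>i. i \<in> I \<Longrightarrow> norm (a i) = 1"
    "\<And>i. i \<in> I \<Longrightarrow> S i = {x. b i \<le> a i \<bullet> x \<and> a i \<bullet> x \<le> b i + w i}"
    by metis
  have w: "w i > 0" if "i \<in> I" for i using S(1)[OF that] unfolding strip_def by blast
  \<comment> \<open>The open strip has the same central hyperplane but twice the width:
    \<open>w i\<close> is now the half-width. Thus it contains the closed strip, and the half-widths
    still sum to at most \<open>\<epsilon>\<close>.\<close>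
  define G where "G = (\<lambda>i. {x. \<bar>a i \<bullet> x - (b i + w i / 2)\<bar> < w i})"
  have "open (G i)" for i
    unfolding G_def by (intro open_Collect_less continuous_intros)
  moreover have "S i \<subseteq> G i" if "i \<in> I" for i
    using ab(2)[OF that] w[OF that] unfolding G_def by (auto simp: abs_if field_simps)
  then have "E \<subseteq> (\<Union>i\<in>I. G i)" using S(2) by blast
  ultimately obtain J where J: "J \<subseteq> I" "finite J" "E \<subseteq> (\<Union>i\<in>J. G i)"
    using compactE_image[OF assms(1), of I G] by metis
  have "sum w J \<le> infsum w I"
    using J S(3) w by (intro finite_sum_le_infsum) (auto simp: less_imp_le)
  then show ?thesis
    using that[of J a w "\<lambda>i. b i + w i / 2"] J ab(1) w S(4) unfolding G_def by force
qed

text \<open>A packing argument: translates of the set by multiples of \<open>2 * c\<close> along the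
  normal are disjoint, and about \<open>1 / (2 * c)\<close> of them fit into the ball enlarged by 1.
  For wide strips the measure of that ball is bound enough.\<close>

lemma measure_strip_Int_ball_le:
  fixes a :: "'a::euclidean_space"
  assumes "norm a = 1" "c > 0"
  shows "measure lebesgue ({x. \<bar>a \<bullet> x - b\<bar> < c} \<inter> ball 0 R)
    \<le> 4 * c * measure lebesgue (ball (0::'a) (R + 1))" (is "measure lebesgue ?T \<le> _ * ?K")
proof -
  have T: "?T \<in> lmeasurable"
    by (intro lmeasurable_open open_Int open_Collect_less continuous_intros) (auto intro: bounded_Int)
  show ?thesis
  proof (cases "2 * c \<le> 1")
    case False
    have "measure lebesgue ?T \<le> ?K"
      using T by (intro measure_mono_fmeasurable) auto
    also have "1 * ?K \<le> 4 * c * ?K" using False by (intro mult_right_mono) auto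
    finally show ?thesis by simp
  next
    case True
    \<comment> \<open>All shifts \<open>2 * c * j\<close> with \<open>j < N\<close> are at most 1.
      Rounding down a number that is at least 1 loses at most half of it, so \<open>N\<close> is at
      least \<open>1 / (4 * c)\<close>; this is the source of the factor 4.\<close>
    define N where "N = nat \<lfloor>1 / (2 * c)\<rfloor>"
    have t: "1 / (2 * c) \<ge> 1" using True assms(2) by simp
    then have "1 \<le> \<lfloor>1 / (2 * c)\<rfloor>" by (simp only: le_floor_iff of_int_1)
    moreover from this have "real N = of_int \<lfloor>1 / (2 * c)\<rfloor>"
      unfolding N_def by (metis of_nat_nat order_trans zero_le_one)
    moreover have "1 / (4 * c) = 1 / (2 * c) / 2" by simp
    ultimately have N: "real N \<le> 1 / (2 * c)" "1 / (4 * c) \<le> real N"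
      using t by linarith+
    have aa: "a \<bullet> a = 1" using assms(1) by (simp add: dot_square_norm)
    define F where "F = (\<lambda>j. (+) ((2 * c * real j) *\<^sub>R a) ` ?T)"
    have F: "F j \<in> lmeasurable" "measure lebesgue (F j) = measure lebesgue ?T" for j
      unfolding F_def using T by (auto intro: measurable_translation simp: measure_translation)
    have "i = j" if "x \<in> F i" "x \<in> F j" for x i j
    proof -
      have "\<bar>a \<bullet> x - 2 * c * real l - b\<bar> < c" if "x \<in> F l" for l
        using that aa unfolding F_def by (auto simp: inner_add_right)
      from this[OF that(1)] this[OF that(2)] have "\<bar>2 * c * real i - 2 * c * real j\<bar> < 2 * c" by linarith
      then have "2 * c * \<bar>real i - real j\<bar> < 2 * c * 1"
        using assms(2) by (simp flip: right_diff_distrib add: abs_mult)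
      then have "\<bar>real i - real j\<bar> < 1" using assms(2) by (simp only: mult_less_cancel_left_pos)
      then show ?thesis by linarith
    qed
    then have disj: "disjoint_family_on F {..<N}" unfolding disjoint_family_on_def by blast
    have sub: "F j \<subseteq> ball 0 (R + 1)" if "j < N" for j
    proof
      fix x assume "x \<in> F j"
      then obtain y where y: "y \<in> ball 0 R" "x = (2 * c * real j) *\<^sub>R a + y" unfolding F_def by auto
      have "2 * c * real j \<le> 2 * c * (1 / (2 * c))"
        using that N assms(2) by (intro mult_left_mono) auto
      then have "norm ((2 * c * real j) *\<^sub>R a) \<le> 1" using assms by simp
      then show "x \<in> ball 0 (R + 1)"
        using y norm_triangle_ineq[of "(2 * c * real j) *\<^sub>R a" y] by simp
    qed
    have "real N * measure lebesgue ?T = (\<Sum>j<N. measure lebesgue (F j))" using F(2) by simp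
    also have "\<dots> = measure lebesgue (\<Union>j<N. F j)"
      using F(1) disj by (intro measure_finite_Union[symmetric]) (auto simp: fmeasurableD fmeasurableD2 simp del: emeasure_completion)
    also have "\<dots> \<le> ?K"
      using F(1) sub by (intro measure_mono_fmeasurable) (auto intro!: sets.finite_UN simp: fmeasurableD)
    finally have "4 * c * (real N * measure lebesgue ?T) \<le> 4 * c * ?K"
      using assms(2) by (intro mult_left_mono) auto
    moreover have "1 \<le> 4 * c * real N"
      using N(2) assms(2) by (simp add: field_simps)
    then have "1 * measure lebesgue ?T \<le> (4 * c * real N) * measure lebesgue ?T"
      by (intro mult_right_mono) auto
    ultimately show ?thesis by simp
  qed
qed

text \<open>Inside a fixed ball the measure of a strip is at most a constant times its width, so
  small total width forces small outer measure.\<close>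

lemma negligible_strip_null:
  fixes E :: "'a::euclidean_space set"
  assumes "compact E" "strip_null E"
  shows "negligible E"
proof -
  obtain R where R: "R > 0" "E \<subseteq> ball 0 R"
    using bounded_subset_ballD[OF compact_imp_bounded[OF assms(1)], of 0] by auto
  define K where "K = measure lebesgue (ball (0::'a) (R + 1))"
  have K: "K \<ge> 0" unfolding K_def by simp
  show ?thesis unfolding negligible_outer_le
  proof (intro allI impI)
    fix e :: real assume "e > 0"
    then have e': "e / (4 * (K + 1)) > 0" using K by simp
    obtain J :: "nat set" and a c b where J: "finite J" "\<And>i. i \<in> J \<Longrightarrow> norm (a i :: 'a) = 1"
      "\<And>i. i \<in> J \<Longrightarrow> c i > 0" "sum c J \<le> e / (4 * (K + 1))"
      "E \<subseteq> (\<Union>i\<in>J. {x. \<bar>a i \<bullet> x - b i\<bar> < c i})"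
      using strip_null_finite_cover[OF assms e'] by blast
    define F where "F = (\<lambda>i. {x. \<bar>a i \<bullet> x - b i\<bar> < c i} \<inter> ball 0 R)"
    have F: "F i \<in> lmeasurable" for i
      unfolding F_def
      by (intro lmeasurable_open open_Int open_Collect_less continuous_intros) (auto intro: bounded_Int)
    have "measure lebesgue (\<Union>i\<in>J. F i) \<le> (\<Sum>i\<in>J. measure lebesgue (F i))"
      using J(1) F by (intro measure_UNION_le) (auto simp: fmeasurableD)
    also have "\<dots> \<le> (\<Sum>i\<in>J. 4 * c i * K)"
      unfolding F_def K_def using J(2,3) by (intro sum_mono measure_strip_Int_ball_le) auto
    also have "\<dots> = 4 * K * sum c J"
      by (simp add: sum_distrib_left sum_distrib_right mult_ac)
    also have "\<dots> \<le> 4 * K * (e / (4 * (K + 1)))" using J(4) K by (intro mult_left_mono) auto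
    also have "\<dots> \<le> e" using K \<open>e > 0\<close> by (simp add: field_simps)
    finally have "measure lebesgue (\<Union>i\<in>J. F i) \<le> e" .
    moreover have "E \<subseteq> (\<Union>i\<in>J. F i)" using J(5) R(2) unfolding F_def by auto
    moreover have "(\<Union>i\<in>J. F i) \<in> lmeasurable" using J(1) F by (intro fmeasurable.finite_UN) auto
    ultimately show "\<exists>T. E \<subseteq> T \<and> T \<in> lmeasurable \<and> measure lebesgue T \<le> e" by blast
  qed
qed

section \<open>Polyhedral images and the two Kolmogorov properties\<close>

lemma negligible_frontier_general_polyhedron:
  assumes "general_polyhedron P"
  shows "negligible (frontier P)"
proof -
  obtain \<H> where \<H>: "finite \<H>" "\<And>H. H \<in> \<H> \<Longrightarrow> affine_hyperplane H" "frontier P \<subseteq> \<Union>\<H>"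
    using assms unfolding general_polyhedron_def by blast
  have "negligible (\<Union>\<H>)"
    using \<H>(1,2) unfolding affine_hyperplane_def
    by (intro negligible_Union) (auto intro: negligible_hyperplane)
  then show ?thesis using \<H>(3) negligible_subset by blast
qed

text \<open>The construction shared by both properties; surjectivity serves the measure
  estimate.\<close>

lemma strip_null_frontier_map:
  fixes A :: "'a::euclidean_space set"
  assumes "bounded A" "strip_null (frontier A)" "\<epsilon> > 0"
  obtains f :: "'a \<Rightarrow> 'a" where "1-lipschitz_on UNIV f" "general_polyhedron (f ` A)"
    "\<And>x. norm (f x - x) \<le> \<epsilon>" "surj f"
proof -
  obtain J :: "nat set" and a c b where J: "finite J" "\<And>i. i \<in> J \<Longrightarrow> norm (a i :: 'a) = 1"
    "\<And>i. i \<in> J \<Longrightarrow> c i > 0" "sum c J \<le> \<epsilon>"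
    "frontier A \<subseteq> (\<Union>i\<in>J. {x. \<bar>a i \<bullet> x - b i\<bar> < c i})"
    using strip_null_finite_cover[OF compact_frontier_bounded[OF assms(1)] assms(2,3)] by blast
  obtain P :: "('a \<times> real) set" where P: "finite P" "P \<noteq> {}"
    "\<forall>p k. (p, k) \<in> P \<longrightarrow> norm p \<le> sum c J"
    "\<forall>x y. y \<notin> \<Union>(creases P) \<longrightarrow> subgradient (max_affine P) y (x - y) \<longrightarrow>
       (\<forall>i\<in>J. c i \<le> \<bar>a i \<bullet> x - b i\<bar>)"
    using max_affine_of_strips[OF J(1-3), where b = b] .
  obtain f where f: "1-lipschitz_on UNIV f" "\<forall>x. norm (f x - x) \<le> sum c J"
    "\<forall>x y. f x = y \<longleftrightarrow> subgradient (max_affine P) y (x - y)"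
    using resolvent_map[OF P(1,2) P(3)[rule_format]] .
  \<comment> \<open>An active slope at \<open>y\<close> is a subgradient there, so
    \<open>y + p\<close> is a preimage of \<open>y\<close>. Since some slope is active at every
    point, \<open>f\<close> is surjective.\<close>
  have pre: "f (y + p) = y" if "(p, k) \<in> P" "max_affine P y = p \<bullet> y + k" for y p k
    using subgradient_max_affine[OF P(1) that] by (simp add: f(3))
  have "surj f" using max_affine_attained[OF P(1,2)] pre by (metis surjI surj_def)
  have "frontier (f ` A) \<subseteq> \<Union>(creases P)"
  proof (rule subsetI, rule ccontr)
    fix y assume y: "y \<in> frontier (f ` A)" "y \<notin> \<Union>(creases P)"
    \<comment> \<open>A frontier point of the image need not have a preimage in \<open>A\<close>;
      compactness provides one in the closure.\<close>
    have "compact (f ` closure A)"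
      using assms(1) continuous_on_subset[OF lipschitz_on_continuous_on[OF f(1)] subset_UNIV]
      by (intro compact_continuous_image) auto
    then have "closure (f ` A) \<subseteq> f ` closure A"
      by (intro closure_minimal image_mono closure_subset compact_imp_closed)
    then obtain x where x: "x \<in> closure A" "f x = y"
      using y(1) unfolding frontier_def by blast
    then have sub: "subgradient (max_affine P) y (x - y)" using f(3) by blast
    \<comment> \<open>Off the creases the preimage avoids every open strip, whereas these strips
      cover the frontier of \<open>A\<close>.\<close>
    have "x \<notin> frontier A" using P(4) y(2) sub J(5) by fastforce
    then have "x \<in> interior A" using x(1) unfolding frontier_def by blast
    then obtain r where r: "r > 0" "ball x r \<subseteq> A" unfolding mem_interior by blast
    obtain p k \<delta> where p: "(p, k) \<in> P" "\<delta> > 0"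
      "\<And>z. z \<in> ball y \<delta> \<Longrightarrow> max_affine P z = p \<bullet> z + k"
      using max_affine_locally_affine[OF P(1,2) y(2)] by blast
    have xp: "x - y = p" by (rule subgradient_locally_affine[OF p(2,3) sub])
    \<comment> \<open>Near \<open>y\<close> the slope \<open>p\<close> remains active, so
      translation by \<open>p\<close> is a local right inverse of \<open>f\<close> and takes
      \<open>z\<close> into the ball around \<open>x\<close> inside \<open>A\<close>.\<close>
    have "z \<in> f ` A" if "z \<in> ball y (min r \<delta>)" for z
    proof -
      have "f (z + p) = z" using pre p(1,3) that by simp
      moreover have "z + p \<in> ball x r" using that by (simp add: dist_norm flip: xp)
      ultimately show ?thesis using r(2) by (metis image_eqI subsetD)
    qed
    moreover have "min r \<delta> > 0" using r(1) p(2) by simp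
    ultimately have "y \<in> interior (f ` A)" unfolding mem_interior by blast
    then show False using y(1) unfolding frontier_def by blast
  qed
  then have "general_polyhedron (f ` A)"
    unfolding general_polyhedron_def
    using finite_creases[OF P(1)] affine_hyperplane_creases by blast
  then show ?thesis using that f(1,2) J(4) \<open>surj f\<close> by (meson order_trans)
qed

lemma distance_kolmogorov_strip_null_frontier:
  fixes A :: "'a::euclidean_space set"
  assumes "bounded A" "strip_null (frontier A)"
  shows "distance_kolmogorov A"
  unfolding distance_kolmogorov_def
proof (intro conjI allI impI)
  fix \<epsilon> :: real assume "\<epsilon> > 0"
  then obtain f :: "'a \<Rightarrow> 'a" where "1-lipschitz_on UNIV f" "general_polyhedron (f ` A)"
    "\<And>x. norm (f x - x) \<le> \<epsilon>"
    using strip_null_frontier_map[OF assms] by blast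
  then show "\<exists>f. 1-lipschitz_on A f \<and> general_polyhedron (f ` A) \<and> (\<forall>x\<in>A. norm (f x - x) \<le> \<epsilon>)"
    using lipschitz_on_subset by blast
qed (fact assms(1))

text \<open>A point of \<open>A\<close> missed by the image has a nearby preimage outside
  \<open>A\<close>, and the segment joining the two meets the frontier of \<open>A\<close>. The
  missed points therefore lie in a thin neighbourhood of a compact null set, which has small
  measure.\<close>

lemma measure_kolmogorov_strip_null_frontier:
  fixes A :: "'a::euclidean_space set"
  assumes "bounded A" "strip_null (frontier A)"
  shows "measure_kolmogorov A"
proof -
  have neg: "negligible (frontier A)"
    using assms by (intro negligible_strip_null compact_frontier_bounded)
  have A: "A \<in> lmeasurable" using assms(1) neg by (simp add: measurable_Jordan)
  have "\<exists>f :: 'a \<Rightarrow> 'a. 1-lipschitz_on A f \<and> general_polyhedron (f ` A) \<and>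
      measure lebesgue (f ` A) > measure lebesgue A - \<epsilon>" if "\<epsilon> > 0" for \<epsilon>
  proof -
    \<comment> \<open>The neighbourhood estimate is applied to the set \<open>frontier A\<close>, so
      the frontier of that set must be null as well.\<close>
    have "negligible (frontier (frontier A))"
      using neg negligible_subset frontier_subset_closed[OF frontier_closed] by blast
    moreover have "bounded (frontier A)"
      by (rule compact_imp_bounded[OF compact_frontier_bounded[OF assms(1)]])
    ultimately obtain d where d: "d > 0"
      "\<And>T. \<lbrakk>T \<in> lmeasurable; \<And>y. y \<in> T \<Longrightarrow> \<exists>x. x \<in> frontier A \<and> dist x y < d\<rbrakk>
         \<Longrightarrow> measure lebesgue T < measure lebesgue (frontier A) + \<epsilon>"
      using measure_semicontinuous_with_hausdist_explicit[OF _ _ \<open>\<epsilon> > 0\<close>] by blast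
    \<comment> \<open>The bound \<open>d / 2\<close> yields the strict inequality \<open>< d\<close>
      that the neighbourhood estimate asks for.\<close>
    obtain f where f: "1-lipschitz_on UNIV f" "general_polyhedron (f ` A)"
      "\<And>x. norm (f x - x) \<le> d / 2" "surj f"
      using strip_null_frontier_map[OF assms, of "d / 2"] d(1) by auto
    have "bounded (f ` A)"
      using assms(1) lipschitz_on_uniformly_continuous[OF lipschitz_on_subset[OF f(1)]]
      by (intro bounded_uniformly_continuous_image) auto
    then have fA: "f ` A \<in> lmeasurable"
      using negligible_frontier_general_polyhedron[OF f(2)] by (simp add: measurable_Jordan)
    have "\<exists>x. x \<in> frontier A \<and> dist x y < d" if y: "y \<in> A - f ` A" for y
    proof -
      obtain x where x: "f x = y" using f(4) by (metis surjD)
      then have "x \<notin> A" using y by blast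
      then have "closed_segment y x \<inter> frontier A \<noteq> {}"
        using y by (intro connected_Int_frontier) auto
      then obtain z where z: "z \<in> closed_segment y x" "z \<in> frontier A" by blast
      have "dist z y \<le> dist x y" using segment_bound1[OF z(1)] by (simp add: dist_norm norm_minus_commute)
      also have "\<dots> < d" using f(3)[of x] x d(1) by (simp add: dist_norm norm_minus_commute)
      finally show ?thesis using z(2) by blast
    qed
    then have "measure lebesgue (A - f ` A) < measure lebesgue (frontier A) + \<epsilon>"
      using A fA by (intro d(2) fmeasurable.Diff) (auto simp: fmeasurableD)
    then have "measure lebesgue (A - f ` A) < \<epsilon>"
      using negligible_imp_measure0[OF neg] by linarith
    moreover have "measure lebesgue A \<le> measure lebesgue ((A - f ` A) \<union> f ` A)"
      using A fA by (intro measure_mono_fmeasurable fmeasurable.Un fmeasurable.Diff) (auto simp: fmeasurableD)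
    moreover have "\<dots> \<le> measure lebesgue (A - f ` A) + measure lebesgue (f ` A)"
      using A fA by (intro measure_Un_le) (auto simp: fmeasurableD)
    ultimately have "measure lebesgue (f ` A) > measure lebesgue A - \<epsilon>" by linarith
    then show ?thesis using f(2) lipschitz_on_subset[OF f(1) subset_UNIV[of A]] by blast
  qed
  then show ?thesis
    unfolding measure_kolmogorov_def using assms(1) A by (auto simp: fmeasurableD)
qed

theorem corollary1p10:
  fixes A :: "(real ^ 'n) set"
  assumes "bounded A" and "strip_null (frontier A)"
  shows "distance_kolmogorov A \<and> measure_kolmogorov A"
  using assms distance_kolmogorov_strip_null_frontier measure_kolmogorov_strip_null_frontier
  by blast

end
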